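(* Let $X$ be a Fréchet space and let $T:X\to X$ be a continuous linear operator. (a) The following are equivalent: (i) $T$ is multiply recurrent; (ii) $T$ has property $\mathcal{P}_{\mathcal{AP}}$; (iii) $T$ is $\mathcal{AP}$-recurrent; (iv) $T$ has property $\mathcal{P}_{\overline{\mathcal{AP}}}$; (v) $T$ is $\overline{\mathcal{AP}}$-recurrent. (b) $T$ is $\mathcal{AP}$-hypercyclic if and only if $T$ is $\overline{\mathcal{AP}}$-hypercyclic.
   Context: An arithmetic progression of length $m+1$ and step (common difference) $k\ge 1$ is a set $\{a,a+k,\dots,a+mk\}\subseteq\mathbb{N}$. $\mathcal{AP}$ is the family of all subsets of $\mathbb{N}$ that contain arbitrarily long arithmetic progressions. $\overline{\mathcal{AP}}$ is the family of all $A\subseteq\mathbb{N}$ such that for every $m$ there is $k\ge 1$ such that $A$ contains infinitely many arithmetic progressions of step $k$ and length $m$. $N_T(x,U)=\{n\in\mathbb{N}: T^n x\in U\}$. Let $\mathcal{F}$ be either of these two families. $T$ has property $\mathcal{P}_{\mathcal{F}}$ if for each nonempty open set $U\subseteq X$ there exists $x\in X$ such that $N_T(x,U)\in\mathcal{F}$. A vector $x$ is $\mathcal{F}$-recurrent if $N_T(x,U)\in\mathcal{F}$ for every open set $U$ containing $x$; $T$ is $\mathcal{F}$-recurrent if its set of $\mathcal{F}$-recurrent vectors is dense in $X$. $T$ is $\mathcal{F}$-hypercyclic if there is $x\in X$ with $N_T(x,U)\in\mathcal{F}$ for every nonempty open $U\subseteq X$. $T$ is multiply recurrent if for every nonempty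 open set $U$ and every $m\in\mathbb{N}$ there is $k\ge 1$ such that $U\cap T^{-k}(U)\cap\dots\cap T^{-km}(U)\neq\emptyset$. *)

theory Defs
  imports "HOL-Analysis.Analysis"
begin

text \<open>
  A Frechet space is a locally convex topological vector space whose topology is induced by a
  complete translation-invariant metric; \<open>dist\<close> is one such metric. Continuity of addition follows
  from translation invariance. The last clause of \<open>locally_convex\<close> spells out \<open>convex V\<close>, which is
  not available inside a class specification. Real scalars also cover complex Frechet spaces, by restriction of
  scalars.
\<close>

class frechet_space = real_vector + complete_space +
  assumes dist_add_right: "dist (x + z) (y + z) = dist x y"
    and tendsto_scaleR_Pair:
      "filterlim (\<lambda>p. fst p *\<^sub>R snd p) (nhds (c *\<^sub>R x)) (nhds c \<times>\<^sub>F nhds x)"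
    and locally_convex: "open U \<Longrightarrow> x \<in> U \<Longrightarrow> \<exists>V. open V \<and> x \<in> V \<and> V \<subseteq> U \<and>
      (\<forall>y\<in>V. \<forall>z\<in>V. \<forall>u\<ge>0. \<forall>v\<ge>0. u + v = 1 \<longrightarrow> u *\<^sub>R y + v *\<^sub>R z \<in> V)"

instance banach \<subseteq> frechet_space
proof
  fix x y z :: 'a and c :: real and U :: "'a set"
  show "dist (x + z) (y + z) = dist x y"
    by (simp add: dist_norm)
  show "filterlim (\<lambda>p. fst p *\<^sub>R snd p) (nhds (c *\<^sub>R x)) (nhds c \<times>\<^sub>F nhds x)"
    by (intro tendsto_scaleR filterlim_fst filterlim_snd)
  assume "open U" "x \<in> U"
  then obtain e where "e > 0" "ball x e \<subseteq> U"
    by (auto simp: open_contains_ball)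
  then show "\<exists>V. open V \<and> x \<in> V \<and> V \<subseteq> U \<and>
      (\<forall>y\<in>V. \<forall>z\<in>V. \<forall>u\<ge>0. \<forall>v\<ge>0. u + v = 1 \<longrightarrow> u *\<^sub>R y + v *\<^sub>R z \<in> V)"
    using convex_ball[of x e] unfolding convex_def by (intro exI[of _ "ball x e"]) auto
qed

definition arith_progression :: "nat \<Rightarrow> nat \<Rightarrow> nat set \<Rightarrow> bool" where
  "arith_progression l k P \<longleftrightarrow> l \<ge> 1 \<and> k \<ge> 1 \<and> (\<exists>a. P = {a + i * k |i. i < l})"

definition AP :: "nat set set" where
  "AP = {A. \<forall>m. \<exists>l\<ge>m. \<exists>k P. arith_progression l k P \<and> P \<subseteq> A}"

text \<open>Lengths are at least one, so \<open>m\<close> starts at one; for \<open>m = 0\<close> the condition would be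
  unsatisfiable.\<close>

definition AP_bar :: "nat set set" where
  "AP_bar = {A. \<forall>m\<ge>1. \<exists>k\<ge>1. infinite {P. arith_progression m k P \<and> P \<subseteq> A}}"

definition return_set :: "('a \<Rightarrow> 'a) \<Rightarrow> 'a \<Rightarrow> 'a set \<Rightarrow> nat set" where
  "return_set T x U = {n. (T ^^ n) x \<in> U}"

definition has_property_P :: "nat set set \<Rightarrow> ('a::topological_space \<Rightarrow> 'a) \<Rightarrow> bool" where
  "has_property_P F T \<longleftrightarrow> (\<forall>U. open U \<and> U \<noteq> {} \<longrightarrow> (\<exists>x. return_set T x U \<in> F))"

definition recurrent_vector :: "nat set set \<Rightarrow> ('a::topological_space \<Rightarrow> 'a) \<Rightarrow> 'a \<Rightarrow> bool" where
  "recurrent_vector F T x \<longleftrightarrow> (\<forall>U. open U \<and> x \<in> U \<longrightarrow> return_set T x U \<in> F)"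

definition family_recurrent :: "nat set set \<Rightarrow> ('a::topological_space \<Rightarrow> 'a) \<Rightarrow> bool" where
  "family_recurrent F T \<longleftrightarrow> closure {x. recurrent_vector F T x} = UNIV"

definition family_hypercyclic :: "nat set set \<Rightarrow> ('a::topological_space \<Rightarrow> 'a) \<Rightarrow> bool" where
  "family_hypercyclic F T \<longleftrightarrow> (\<exists>x. \<forall>U. open U \<and> U \<noteq> {} \<longrightarrow> return_set T x U \<in> F)"

definition multiply_recurrent :: "('a::topological_space \<Rightarrow> 'a) \<Rightarrow> bool" where
  "multiply_recurrent T \<longleftrightarrow>
    (\<forall>U m. open U \<and> U \<noteq> {} \<longrightarrow> (\<exists>k\<ge>1. (\<Inter>j\<in>{0..m}. (T ^^ (k * j)) -` U) \<noteq> {}))"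

end

theory Submission
  imports Defs
begin

text \<open>
  Only two implications have content; the others rest on \<open>AP_bar \<subseteq> AP\<close>, on the fact that a dense
  set of recurrent vectors meets every nonempty open set, and on the observation that, if a
  progression \<open>a, a + k, \<dots>, a + m * k\<close> lies in the return set of \<open>x\<close> to \<open>U\<close>, then the point
  \<open>(T ^^ a) x\<close> is in \<open>U\<close> at the times \<open>0, k, \<dots>, m * k\<close>.

  The link between the two families is that a progression of length \<open>m\<close> and step \<open>k\<close> is encoded in
  a single open set \<open>V = (\<Inter>i\<in>{..<m}. (T ^^ (k * i)) -` U)\<close>: each visit to \<open>V\<close> at a time \<open>a\<close> gives
  the progression \<open>a, a + k, \<dots>\<close> of visits to \<open>U\<close>. Infinitely many visits to \<open>V\<close> therefore give
  infinitely many progressions of one common step (\<open>return_set_AP_bar_if_infinite_returns\<close>).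

  If \<open>x\<close> is hypercyclic for \<open>AP\<close>, one progression in its return set to \<open>U\<close> makes \<open>V\<close> nonempty, and
  the orbit of \<open>x\<close> then visits \<open>V\<close> infinitely often; so the same \<open>x\<close> is hypercyclic for \<open>AP_bar\<close>
  (\<open>family_hypercyclic_AP_bar_if_AP\<close>).

  If \<open>T\<close> is multiply recurrent, then for all \<open>r\<close> and \<open>m\<close> the points that come back within
  \<open>1 / (r + 1)\<close> of themselves at the times \<open>k, 2 * k, \<dots>, m * k\<close>, for some \<open>k \<ge> 1\<close>, form a dense
  open set. By the Baire category theorem, a dense set of points has this property for all \<open>r\<close> and
  \<open>m\<close> at once. Given a neighbourhood \<open>U\<close> of such a point \<open>x\<close>, some \<open>k\<close> puts \<open>x\<close> in the
  corresponding \<open>V\<close>. The same property makes \<open>x\<close> return to \<open>V\<close> at arbitrarily late times, since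
  \<open>m * k\<close> is at least \<open>m\<close>. Hence \<open>x\<close> is recurrent for \<open>AP_bar\<close>
  (\<open>family_recurrent_AP_bar_if_multiply_recurrent\<close>).
\<close>

section \<open>Iterates of a continuous map\<close>

lemma continuous_on_funpow:
  fixes T :: "'a::topological_space \<Rightarrow> 'a"
  assumes "continuous_on UNIV T"
  shows "continuous_on UNIV (T ^^ n)"
proof (induction n)
  case (Suc n)
  then show ?case
    using assms by (auto simp: o_def intro: continuous_on_compose2)
qed (simp add: id_def)

lemma open_INT_funpow_vimage:
  fixes T :: "'a::topological_space \<Rightarrow> 'a"
  assumes "continuous_on UNIV T" and "open U" and "finite I"
  shows "open (\<Inter>j\<in>I. (T ^^ (k * j)) -` U)"
  using assms by (intro open_INT ballI open_vimage continuous_on_funpow)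

section \<open>Sets containing long arithmetic progressions\<close>

lemma AP_bar_subset_AP: "AP_bar \<subseteq> AP"
proof
  fix A assume A: "A \<in> AP_bar"
  have "\<exists>l\<ge>m. \<exists>k P. arith_progression l k P \<and> P \<subseteq> A" for m
  proof -
    from A obtain k where "infinite {P. arith_progression (Suc m) k P \<and> P \<subseteq> A}"
      unfolding AP_bar_def by auto
    then obtain P where "arith_progression (Suc m) k P" "P \<subseteq> A"
      using not_finite_existsD by blast
    then show ?thesis
      by (intro exI[of _ "Suc m"]) auto
  qed
  then show "A \<in> AP"
    by (simp add: AP_def)
qed

lemma AP_obtain_progression:
  assumes "A \<in> AP"
  obtains a k where "k \<ge> 1" "\<And>i. i < m \<Longrightarrow> a + k * i \<in> A"
proof -
  from assms obtain l k P where l: "l \<ge> m" "arith_progression l k P" "P \<subseteq> A"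
    unfolding AP_def by blast
  then obtain a where "P = {a + i * k |i. i < l}" "k \<ge> 1"
    by (auto simp: arith_progression_def)
  then have "k \<ge> 1" "\<And>i. i < m \<Longrightarrow> a + k * i \<in> A"
    using l by (auto simp: mult.commute)
  then show thesis
    using that by blast
qed

lemma AP_infinite:
  assumes "A \<in> AP"
  shows "infinite A"
proof
  assume "finite A"
  obtain a k where k: "k \<ge> 1" "\<And>i. i < Suc (card A) \<Longrightarrow> a + k * i \<in> A"
    using AP_obtain_progression[OF assms] by blast
  have "card ((\<lambda>i. a + k * i) ` {..<Suc (card A)}) \<le> card A"
    using k \<open>finite A\<close> by (intro card_mono) auto
  moreover have "inj_on (\<lambda>i. a + k * i) {..<Suc (card A)}"
    using k(1) by (auto simp: inj_on_def)
  ultimately show False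
    by (simp add: card_image)
qed

lemma AP_barI:
  assumes "\<And>m. m \<ge> 1 \<Longrightarrow> \<exists>k\<ge>1. infinite {a. \<forall>i<m. a + k * i \<in> A}"
  shows "A \<in> AP_bar"
  unfolding AP_bar_def
proof (intro CollectI allI impI)
  fix m :: nat assume m: "m \<ge> 1"
  then obtain k where k: "k \<ge> 1" "infinite {a. \<forall>i<m. a + k * i \<in> A}"
    using assms by blast
  let ?P = "\<lambda>a. {a + i * k |i. i < m}"
  \<comment> \<open>Distinct starting points give distinct progressions, as the start is the least element.\<close>
  have "Inf (?P a) = a" for a
    using m by (intro cInf_eq_minimum) (auto intro: exI[of _ "0::nat"])
  then have "inj ?P"
    by (rule inj_on_inverseI)
  then have "infinite (?P ` {a. \<forall>i<m. a + k * i \<in> A})"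
    using k(2) by (meson finite_imageD inj_on_subset subset_UNIV)
  moreover have "?P ` {a. \<forall>i<m. a + k * i \<in> A} \<subseteq> {P. arith_progression m k P \<and> P \<subseteq> A}"
    using m k(1) by (auto simp: arith_progression_def mult.commute)
  ultimately show "\<exists>k\<ge>1. infinite {P. arith_progression m k P \<and> P \<subseteq> A}"
    using k(1) finite_subset by blast
qed

section \<open>Progressions of return times\<close>

lemma return_set_INT_funpow_vimage:
  "return_set T x (\<Inter>i\<in>{..<m}. (T ^^ (k * i)) -` U) = {a. \<forall>i<m. a + k * i \<in> return_set T x U}"
proof -
  have "(T ^^ (k * i)) ((T ^^ a) x) = (T ^^ (a + k * i)) x" for a i
    by (simp add: add.commute[of a] funpow_add)
  then show ?thesis
    by (auto simp: return_set_def)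
qed

lemma return_set_AP_bar_if_infinite_returns:
  assumes "\<And>m. \<exists>k\<ge>1. infinite (return_set T x (\<Inter>i\<in>{..<m}. (T ^^ (k * i)) -` U))"
  shows "return_set T x U \<in> AP_bar"
  using assms by (intro AP_barI) (simp add: return_set_INT_funpow_vimage)

text \<open>The witness is the point of the orbit of \<open>x\<close> at the start of a progression.\<close>

lemma return_set_AP_meets_INT:
  assumes "return_set T x U \<in> AP"
  obtains k where "k \<ge> 1" "(\<Inter>i\<in>{..<m}. (T ^^ (k * i)) -` U) \<noteq> {}"
proof -
  obtain a k where "k \<ge> 1" "\<And>i. i < m \<Longrightarrow> a + k * i \<in> return_set T x U"
    using AP_obtain_progression[OF assms] by blast
  then have "a \<in> return_set T x (\<Inter>i\<in>{..<m}. (T ^^ (k * i)) -` U)"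
    by (simp add: return_set_INT_funpow_vimage)
  then have "(T ^^ a) x \<in> (\<Inter>i\<in>{..<m}. (T ^^ (k * i)) -` U)"
    by (simp only: return_set_def mem_Collect_eq)
  then show thesis
    using that \<open>k \<ge> 1\<close> by blast
qed

section \<open>Comparison of the recurrence notions\<close>

lemma multiply_recurrent_if_property_P_AP:
  fixes T :: "'a::topological_space \<Rightarrow> 'a"
  assumes "has_property_P AP T"
  shows "multiply_recurrent T"
  unfolding multiply_recurrent_def
proof (intro allI impI)
  fix U :: "'a set" and m assume "open U \<and> U \<noteq> {}"
  then obtain x where "return_set T x U \<in> AP"
    using assms unfolding has_property_P_def by blast
  then obtain k where "k \<ge> 1" "(\<Inter>i\<in>{..<Suc m}. (T ^^ (k * i)) -` U) \<noteq> {}"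
    by (rule return_set_AP_meets_INT)
  then show "\<exists>k\<ge>1. (\<Inter>j\<in>{0..m}. (T ^^ (k * j)) -` U) \<noteq> {}"
    by (auto simp: lessThan_Suc_atMost atLeast0AtMost)
qed

lemma property_P_if_family_recurrent:
  fixes T :: "'a::topological_space \<Rightarrow> 'a"
  assumes "family_recurrent F T"
  shows "has_property_P F T"
  unfolding has_property_P_def
proof (intro allI impI)
  fix U :: "'a set" assume U: "open U \<and> U \<noteq> {}"
  then have "U \<inter> closure {x. recurrent_vector F T x} \<noteq> {}"
    using assms by (simp add: family_recurrent_def)
  then obtain x where "x \<in> U" "recurrent_vector F T x"
    using U open_Int_closure_eq_empty by blast
  then show "\<exists>x. return_set T x U \<in> F"
    using U unfolding recurrent_vector_def by blast
qed

lemma has_property_P_mono: "F \<subseteq> G \<Longrightarrow> has_property_P F T \<Longrightarrow> has_property_P G T"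
  unfolding has_property_P_def by blast

lemma recurrent_vector_mono: "F \<subseteq> G \<Longrightarrow> recurrent_vector F T x \<Longrightarrow> recurrent_vector G T x"
  unfolding recurrent_vector_def by blast

lemma family_recurrent_mono:
  assumes "F \<subseteq> G" "family_recurrent F T"
  shows "family_recurrent G T"
proof -
  have "closure {x. recurrent_vector F T x} \<subseteq> closure {x. recurrent_vector G T x}"
    using recurrent_vector_mono[OF assms(1)] by (intro closure_mono) auto
  then show ?thesis
    using assms(2) by (auto simp: family_recurrent_def)
qed

lemma family_hypercyclic_mono:
  "F \<subseteq> G \<Longrightarrow> family_hypercyclic F T \<Longrightarrow> family_hypercyclic G T"
  unfolding family_hypercyclic_def by blast

section \<open>Multiple recurrence and Baire category\<close>

definition near_returns :: "('a::metric_space \<Rightarrow> 'a) \<Rightarrow> real \<Rightarrow> nat \<Rightarrow> 'a set" where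
  "near_returns T e m = {x. \<exists>k\<ge>1. \<forall>i\<le>m. dist ((T ^^ (k * i)) x) x < e}"

lemma open_near_returns:
  fixes T :: "'a::metric_space \<Rightarrow> 'a"
  assumes "continuous_on UNIV T"
  shows "open (near_returns T e m)"
proof -
  have "near_returns T e m = (\<Union>k\<in>{1..}. \<Inter>i\<in>{..m}. {x. dist ((T ^^ (k * i)) x) x < e})"
    by (auto simp: near_returns_def)
  also have "open \<dots>"
    using continuous_on_funpow[OF assms]
    by (intro open_UN open_INT ballI open_Collect_less continuous_intros) auto
  finally show ?thesis .
qed

lemma closure_near_returns:
  fixes T :: "'a::metric_space \<Rightarrow> 'a"
  assumes "multiply_recurrent T" "e > 0"
  shows "closure (near_returns T e m) = UNIV"
proof -
  have "\<exists>y\<in>near_returns T e m. dist y x < d" if "d > 0" for x d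
  proof -
    \<comment> \<open>Two points of a ball of radius at most \<open>e/2\<close> have distance less than \<open>e\<close>.\<close>
    let ?U = "ball x (min d (e / 2))"
    have "open ?U \<and> ?U \<noteq> {}"
      using that assms(2) by simp
    then obtain k y where k: "k \<ge> 1" "y \<in> (\<Inter>j\<in>{0..m}. (T ^^ (k * j)) -` ?U)"
      using assms(1) unfolding multiply_recurrent_def by blast
    then have U: "(T ^^ (k * i)) y \<in> ?U" if "i \<le> m" for i
      using that by auto
    from U[of 0] have y: "y \<in> ?U"
      by simp
    have "dist ((T ^^ (k * i)) y) y < e" if "i \<le> m" for i
      using U[OF that] y dist_triangle_half_r[of x "(T ^^ (k * i)) y" e y]
      by simp
    then have "y \<in> near_returns T e m"
      using k(1) by (auto simp: near_returns_def)
    moreover have "dist y x < d"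
      using y by (simp add: dist_commute)
    ultimately show ?thesis
      by blast
  qed
  then show ?thesis
    by (auto simp: closure_approachable)
qed

text \<open>Asking for \<open>n\<close> successive near returns forces a late one: the last of them happens at a
  time \<open>k * n \<ge> n\<close>.\<close>

lemma infinite_returns_if_near_returns:
  assumes "x \<in> (\<Inter>r m. near_returns T (1 / real (Suc r)) m)" "open V" "x \<in> V"
  shows "infinite (return_set T x V)"
  unfolding infinite_nat_iff_unbounded_le
proof
  fix n
  obtain e where e: "e > 0" "ball x e \<subseteq> V"
    using assms open_contains_ball by blast
  obtain r where r: "1 / real (Suc r) < e"
    using nat_approx_posE[OF e(1)] by auto
  from assms(1) have "x \<in> near_returns T (1 / real (Suc r)) n"
    by blast
  then obtain k where k: "k \<ge> 1" "dist ((T ^^ (k * n)) x) x < 1 / real (Suc r)"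
    unfolding near_returns_def by blast
  with r e have "k * n \<in> return_set T x V"
    by (auto simp: return_set_def dist_commute subset_iff)
  moreover have "k * n \<ge> n"
    using k(1) by simp
  ultimately show "\<exists>n'\<ge>n. n' \<in> return_set T x V"
    by blast
qed

text \<open>The near returns are used twice: for a progression of times \<open>0, k, \<dots>\<close> that keeps \<open>x\<close> in \<open>U\<close>,
  and, once \<open>k\<close> is fixed, for infinitely many returns to the open set of points that are in \<open>U\<close> at these
  times.\<close>

lemma recurrent_AP_bar_if_near_returns:
  fixes T :: "'a::metric_space \<Rightarrow> 'a"
  assumes cont: "continuous_on UNIV T"
    and x: "x \<in> (\<Inter>r m. near_returns T (1 / real (Suc r)) m)"
  shows "recurrent_vector AP_bar T x"
  unfolding recurrent_vector_def
proof (intro allI impI return_set_AP_bar_if_infinite_returns)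
  fix U m assume U: "open U \<and> x \<in> U"
  then obtain e where e: "e > 0" "ball x e \<subseteq> U"
    using open_contains_ball by blast
  obtain r where r: "1 / real (Suc r) < e"
    using nat_approx_posE[OF e(1)] by auto
  from x have "x \<in> near_returns T (1 / real (Suc r)) m"
    by blast
  then obtain k where k: "k \<ge> 1" "\<forall>i\<le>m. dist ((T ^^ (k * i)) x) x < 1 / real (Suc r)"
    unfolding near_returns_def by blast
  let ?V = "\<Inter>i\<in>{..<m}. (T ^^ (k * i)) -` U"
  have "(T ^^ (k * i)) x \<in> U" if "i < m" for i
  proof -
    have "dist ((T ^^ (k * i)) x) x < e"
      using k(2) r that by (meson less_imp_le less_trans)
    then show ?thesis
      using e(2) by (auto simp: dist_commute subset_iff)
  qed
  then have "x \<in> ?V"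
    by simp
  moreover have "open ?V"
    using cont U by (intro open_INT_funpow_vimage) auto
  ultimately show "\<exists>k\<ge>1. infinite (return_set T x (\<Inter>i\<in>{..<m}. (T ^^ (k * i)) -` U))"
    using k(1) infinite_returns_if_near_returns[OF x] by blast
qed

theorem family_recurrent_AP_bar_if_multiply_recurrent:
  fixes T :: "'a::complete_space \<Rightarrow> 'a"
  assumes "continuous_on UNIV T" "multiply_recurrent T"
  shows "family_recurrent AP_bar T"
proof -
  let ?G = "\<lambda>(r, m). near_returns T (1 / real (Suc r)) m"
  have "euclidean closure_of (\<Inter>(range ?G)) = topspace (euclidean :: 'a topology)"
    using open_near_returns[OF assms(1)] closure_near_returns[OF assms(2)]
    by (intro Baire_category) (auto simp: completely_metrizable_space_euclidean)
  then have "closure (\<Inter>(range ?G)) = UNIV"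
    by simp
  moreover have "\<Inter>(range ?G) \<subseteq> {x. recurrent_vector AP_bar T x}"
    using recurrent_AP_bar_if_near_returns[OF assms(1)] by auto
  ultimately show ?thesis
    unfolding family_recurrent_def using closure_mono by blast
qed

section \<open>Hypercyclicity and the equivalences\<close>

theorem family_hypercyclic_AP_bar_if_AP:
  fixes T :: "'a::topological_space \<Rightarrow> 'a"
  assumes cont: "continuous_on UNIV T" and "family_hypercyclic AP T"
  shows "family_hypercyclic AP_bar T"
proof -
  obtain x where x: "\<And>U. open U \<Longrightarrow> U \<noteq> {} \<Longrightarrow> return_set T x U \<in> AP"
    using assms(2) unfolding family_hypercyclic_def by blast
  have "return_set T x U \<in> AP_bar" if "open U" "U \<noteq> {}" for U
  proof (rule return_set_AP_bar_if_infinite_returns)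
    fix m
    have "return_set T x U \<in> AP"
      using x that by blast
    then obtain k where k: "k \<ge> 1" "(\<Inter>i\<in>{..<m}. (T ^^ (k * i)) -` U) \<noteq> {}"
      by (rule return_set_AP_meets_INT)
    moreover have "open (\<Inter>i\<in>{..<m}. (T ^^ (k * i)) -` U)"
      using cont that(1) by (intro open_INT_funpow_vimage) auto
    ultimately show "\<exists>k\<ge>1. infinite (return_set T x (\<Inter>i\<in>{..<m}. (T ^^ (k * i)) -` U))"
      using x AP_infinite by blast
  qed
  then show ?thesis
    unfolding family_hypercyclic_def by blast
qed

theorem proposition5p4:
  fixes T :: "'a::frechet_space \<Rightarrow> 'a"
  assumes "linear T"
    and "continuous_on UNIV T"
  shows "((multiply_recurrent T \<longleftrightarrow> has_property_P AP T) \<and>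
         (has_property_P AP T \<longleftrightarrow> family_recurrent AP T) \<and>
         (family_recurrent AP T \<longleftrightarrow> has_property_P AP_bar T) \<and>
         (has_property_P AP_bar T \<longleftrightarrow> family_recurrent AP_bar T)) \<and>
         (family_hypercyclic AP T \<longleftrightarrow> family_hypercyclic AP_bar T)"
  using multiply_recurrent_if_property_P_AP[of T]
    family_recurrent_AP_bar_if_multiply_recurrent[OF assms(2)]
    family_recurrent_mono[OF AP_bar_subset_AP, of T]
    has_property_P_mono[OF AP_bar_subset_AP, of T]
    property_P_if_family_recurrent[of AP T] property_P_if_family_recurrent[of AP_bar T]
    family_hypercyclic_AP_bar_if_AP[OF assms(2)]
    family_hypercyclic_mono[OF AP_bar_subset_AP, of T]
  by blast

end
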